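(* Let $(\mathcal{X},\mathcal{G},\mathcal{B})$ be a transversal design $TD(k,n)$ with $k\geq n$. The transpose of its incidence matrix forms a $\left(K=n^{2},\;F=kn,\;(1-\frac{M}{N})=\frac{1}{n}\right)$-caching matrix. Further, there is a transmission scheme (for the caching scheme defined by this matrix) with rate $R=1$.
   Context: A transversal design $TD(k,n)$ (index $\lambda=1$) is a triple $(\mathcal{X},\mathcal{G},\mathcal{B})$ where $\mathcal{X}$ is a set of $kn$ elements; $\mathcal{G}$ is a partition of $\mathcal{X}$ into $k$ sets (groups), each of size $n$; $\mathcal{B}$ is a collection of $k$-sized subsets of $\mathcal{X}$ (blocks); and every pair of elements of $\mathcal{X}$ is contained either in exactly one group or in exactly one block, but not both. It is a recorded property of such designs that $|\mathcal{B}|=n^2$ and each element of $\mathcal{X}$ occurs in exactly $n$ blocks. The transpose of the incidence matrix has rows indexed by blocks $A\in\mathcal{B}$, columns indexed by points $x\in\mathcal{X}$, and entry $1$ if $x\in A$, $0$ otherwise. Coded caching model: a server holds $N$ files $W_1,\dots,W_N$ of equal size and is connected by an error-free broadcast link to $K$ users indexed by $\mathcal{U}$, $|\mathcal{U}|=K$. Each file $W_i$ is split into $F$ subfiles $W_{i,f}$, $f\in\mathcal{F}$, $|\mathcal{F}|=F$, of the same size and taking values in an abelian group. After the caches are filled, each user $u$ demands a file $W_{d_u}$, $d_u\in[N]$. The server broadcasts transmissions, each a linear combination (sum) of subfiles of demanded files; a transmission scheme is valid if, for all demands, every user $u$ can recover all subfiles of $W_{d_u}$ from its cache and the transmissions.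 The rate is $R=\frac{\text{number of transmissions}}{F}$. Caching matrix: a binary matrix $C$ with rows indexed by a $K$-set $\mathcal{U}$ and columns by an $F$-set $\mathcal{F}$, with the same number $Z$ of $1$'s in every row. It defines the caching scheme in which user $u$ caches $W_{i,f}$ for all $i\in[N]$ if $C(u,f)=0$, and does not cache it if $C(u,f)=1$; the uncached fraction is $1-\frac{M}{N}=\frac{Z}{F}$. $C$ is then called a $(K,F,(1-\frac{M}{N}))$-caching matrix. *)

theory Defs
  imports Complex_Main "HOL-Library.FuncSet" "HOL-Library.Disjoint_Sets"
begin

section \<open>Transversal designs of index one\<close>

text \<open>
  As is standard, \<open>k \<ge> 2\<close> and \<open>n \<ge> 1\<close>. A family of blocks is a set: for \<open>k \<ge> 2\<close> a repeated
  block would put some pair of points into two blocks.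
  In the last clause a pair (two distinct points) lies either in exactly one group and in no
  block, or in no group and in exactly one block.
\<close>

definition transversal_design ::
  "nat \<Rightarrow> nat \<Rightarrow> 'x set \<Rightarrow> 'x set set \<Rightarrow> 'x set set \<Rightarrow> bool" where
  "transversal_design k n X \<G> \<B> \<longleftrightarrow>
     2 \<le> k \<and> 1 \<le> n \<and>
     finite X \<and> card X = k * n \<and>
     partition_on X \<G> \<and> card \<G> = k \<and> (\<forall>G\<in>\<G>. card G = n) \<and>
     (\<forall>A\<in>\<B>. A \<subseteq> X \<and> card A = k) \<and>
     (\<forall>x\<in>X. \<forall>y\<in>X. x \<noteq> y \<longrightarrow>
        ((\<exists>!G. G \<in> \<G> \<and> {x, y} \<subseteq> G) \<and> \<not> (\<exists>A\<in>\<B>. {x, y} \<subseteq> A)) \<or>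
        (\<not> (\<exists>G\<in>\<G>. {x, y} \<subseteq> G) \<and> (\<exists>!A. A \<in> \<B> \<and> {x, y} \<subseteq> A)))"

text \<open>
  A matrix with rows and columns indexed by sets is a function of two arguments; only its values
  on the index sets matter.
\<close>

definition incidence_matrix :: "'x \<Rightarrow> 'x set \<Rightarrow> nat" where
  "incidence_matrix x A = (if x \<in> A then 1 else 0)"

definition matrix_transpose :: "('a \<Rightarrow> 'b \<Rightarrow> 'c) \<Rightarrow> 'b \<Rightarrow> 'a \<Rightarrow> 'c" where
  "matrix_transpose C = (\<lambda>j i. C i j)"


section \<open>Coded caching\<close>

text \<open>
  \<open>U\<close> indexes the users, \<open>F\<close> the subfiles of each file; \<open>\<rho>\<close> is the uncached fraction
  \<open>1 - M / N = Z / F\<close>.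
\<close>

definition caching_matrix ::
  "'u set \<Rightarrow> 'f set \<Rightarrow> ('u \<Rightarrow> 'f \<Rightarrow> nat) \<Rightarrow> nat \<Rightarrow> nat \<Rightarrow> real \<Rightarrow> bool" where
  "caching_matrix U F C K Fn \<rho> \<longleftrightarrow>
     finite U \<and> card U = K \<and> finite F \<and> card F = Fn \<and> 0 < Fn \<and>
     (\<forall>u\<in>U. \<forall>f\<in>F. C u f \<in> {0, 1}) \<and>
     (\<exists>Z. (\<forall>u\<in>U. card {f \<in> F. C u f = 1} = Z) \<and> \<rho> = real Z / real Fn)"

text \<open>
  The file library is \<open>W :: nat \<Rightarrow> 'f \<Rightarrow> 'g\<close>: subfile \<open>f\<close> of file \<open>i \<in> {1..N}\<close> is the element
  \<open>W i f\<close> of the abelian group \<open>'g\<close>. A user caches the subfiles whose matrix entry is \<open>0\<close>;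
  \<open>None\<close> marks everything that is not in the cache.
\<close>

definition cache_content ::
  "nat \<Rightarrow> 'f set \<Rightarrow> ('u \<Rightarrow> 'f \<Rightarrow> nat) \<Rightarrow> 'u \<Rightarrow> (nat \<Rightarrow> 'f \<Rightarrow> 'g) \<Rightarrow> nat \<Rightarrow> 'f \<Rightarrow> 'g option" where
  "cache_content N F C u W =
     (\<lambda>i f. if i \<in> {1..N} \<and> f \<in> F \<and> C u f = 0 then Some (W i f) else None)"

definition demands :: "nat \<Rightarrow> 'u set \<Rightarrow> ('u \<Rightarrow> nat) set" where
  "demands N U = U \<rightarrow>\<^sub>E {1..N}"

text \<open>
  A transmission is described by the set of (file, subfile) indices that are summed up, and a
  transmission scheme assigns to each demand vector the list of transmissions to be broadcast.
\<close>

type_synonym 'f transmission = "(nat \<times> 'f) set"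

type_synonym ('u, 'f) transmission_scheme = "('u \<Rightarrow> nat) \<Rightarrow> 'f transmission list"

definition transmitted :: "(nat \<Rightarrow> 'f \<Rightarrow> 'g::ab_group_add) \<Rightarrow> 'f transmission \<Rightarrow> 'g" where
  "transmitted W T = (\<Sum>(i, f)\<in>T. W i f)"

text \<open>
  The decoder of a user may depend on the user and on the demand vector, but not on \<open>W\<close>, of which
  it sees only the cache content and the transmitted group elements.
\<close>

definition can_recover ::
  "'g::ab_group_add itself \<Rightarrow> nat \<Rightarrow> 'f set \<Rightarrow> ('u \<Rightarrow> 'f \<Rightarrow> nat) \<Rightarrow> ('u \<Rightarrow> nat) \<Rightarrow>
     'f transmission list \<Rightarrow> 'u \<Rightarrow> bool" where
  "can_recover _ N F C d Ts u \<longleftrightarrow>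
     (\<exists>decode :: (nat \<Rightarrow> 'f \<Rightarrow> 'g option) \<Rightarrow> 'g list \<Rightarrow> 'f \<Rightarrow> 'g.
        \<forall>W :: nat \<Rightarrow> 'f \<Rightarrow> 'g. \<forall>f\<in>F.
          decode (cache_content N F C u W) (map (transmitted W) Ts) f = W (d u) f)"

definition valid_transmission_scheme ::
  "'g::ab_group_add itself \<Rightarrow> nat \<Rightarrow> 'u set \<Rightarrow> 'f set \<Rightarrow> ('u \<Rightarrow> 'f \<Rightarrow> nat) \<Rightarrow>
     ('u, 'f) transmission_scheme \<Rightarrow> bool" where
  "valid_transmission_scheme g N U F C S \<longleftrightarrow>
     (\<forall>d\<in>demands N U.
        (\<forall>T\<in>set (S d). T \<subseteq> d ` U \<times> F) \<and>
        (\<forall>u\<in>U. can_recover g N F C d (S d) u))"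

definition has_rate ::
  "nat \<Rightarrow> 'u set \<Rightarrow> 'f set \<Rightarrow> ('u, 'f) transmission_scheme \<Rightarrow> real \<Rightarrow> bool" where
  "has_rate N U F S R \<longleftrightarrow> (\<forall>d\<in>demands N U. real (length (S d)) / real (card F) = R)"

end

theory Submission
  imports Defs
begin

text \<open>
  Each block \<open>A\<close> carries a fixed-point free permutation \<open>\<phi> A\<close>. For every point \<open>x\<close>
  broadcast the sum, over the blocks \<open>A\<close> through \<open>x\<close>, of subfile \<open>\<phi> A x\<close> of the file demanded
  by \<open>A\<close>. Two blocks through \<open>x\<close> share no other point, so user \<open>A\<close> caches every summand except
  its own and recovers subfile \<open>\<phi> A x\<close>; as \<open>x\<close> runs through \<open>A\<close>, so does \<open>\<phi> A x\<close>.
  For \<open>\<bar>\<B>\<bar> = n\<^sup>2\<close>, fix two groups: a block is determined by the one point it has in each of them.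
\<close>

text \<open>The cyclic shift \<open>i\<close> to \<open>i + 1\<close> modulo \<open>m\<close>,
  transported along an enumeration of \<open>A\<close>, moves every point because \<open>m\<close>
  is at least 2.\<close>

lemma ex_derangement:
  assumes "finite A" and "2 \<le> card A"
  obtains \<phi> where "bij_betw \<phi> A A" and "\<And>x. x \<in> A \<Longrightarrow> \<phi> x \<noteq> x"
proof -
  define m where "m = card A"
  obtain h where h: "bij_betw h A {0..<m}"
    using assms(1) m_def ex_bij_betw_finite_nat by blast
  define s where "s i = Suc i mod m" for i
  have s_ne: "s i \<noteq> i" if "i < m" for i
    using that assms(2) unfolding s_def m_def[symmetric] by (cases "Suc i = m") auto
  have "inj_on s {0..<m}"
    by (intro inj_onI) (auto simp: s_def mod_Suc split: if_splits)
  moreover have "s ` {0..<m} \<subseteq> {0..<m}"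
    using assms(2) by (auto simp: s_def m_def)
  ultimately have s: "bij_betw s {0..<m} {0..<m}"
    by (simp add: bij_betw_def endo_inj_surj)
  have "bij_betw (inv_into A h \<circ> s \<circ> h) A A"
    using h s bij_betw_inv_into[OF h] by (blast intro: bij_betw_trans)
  moreover have "(inv_into A h \<circ> s \<circ> h) x \<noteq> x" if "x \<in> A" for x
  proof
    \<comment> \<open>Applying \<open>h\<close> to both sides would make \<open>h x\<close> a fixed
      point of the shift \<open>s\<close>.\<close>
    assume eq: "(inv_into A h \<circ> s \<circ> h) x = x"
    have "h x \<in> {0..<m}" using h that by (rule bij_betw_apply)
    moreover from this have "s (h x) \<in> {0..<m}" by (rule bij_betw_apply[OF s])
    ultimately show False
      using eq s_ne[of "h x"] bij_betw_inv_into_right[OF h, of "s (h x)"] by simp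
  qed
  ultimately show thesis using that by blast
qed

lemma transversal_design_pair:
  assumes "transversal_design k n X \<G> \<B>" and "x \<in> X" and "y \<in> X" and "x \<noteq> y"
  shows "(\<exists>G\<in>\<G>. x \<in> G \<and> y \<in> G) \<longleftrightarrow> \<not> (\<exists>A\<in>\<B>. x \<in> A \<and> y \<in> A)"
    and "A \<in> \<B> \<Longrightarrow> B \<in> \<B> \<Longrightarrow> x \<in> A \<Longrightarrow> y \<in> A \<Longrightarrow> x \<in> B \<Longrightarrow> y \<in> B \<Longrightarrow> A = B"
proof -
  have "((\<exists>!G. G \<in> \<G> \<and> {x, y} \<subseteq> G) \<and> \<not> (\<exists>A\<in>\<B>. {x, y} \<subseteq> A)) \<or>
      (\<not> (\<exists>G\<in>\<G>. {x, y} \<subseteq> G) \<and> (\<exists>!A. A \<in> \<B> \<and> {x, y} \<subseteq> A))"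
    using assms by (simp only: transversal_design_def) simp
  then have *: "((\<exists>!G. G \<in> \<G> \<and> x \<in> G \<and> y \<in> G) \<and> \<not> (\<exists>A\<in>\<B>. x \<in> A \<and> y \<in> A)) \<or>
      (\<not> (\<exists>G\<in>\<G>. x \<in> G \<and> y \<in> G) \<and> (\<exists>!A. A \<in> \<B> \<and> x \<in> A \<and> y \<in> A))"
    by simp
  show "(\<exists>G\<in>\<G>. x \<in> G \<and> y \<in> G) \<longleftrightarrow> \<not> (\<exists>A\<in>\<B>. x \<in> A \<and> y \<in> A)"
    using * by metis
  show "A \<in> \<B> \<Longrightarrow> B \<in> \<B> \<Longrightarrow> x \<in> A \<Longrightarrow> y \<in> A \<Longrightarrow> x \<in> B \<Longrightarrow> y \<in> B \<Longrightarrow> A = B"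
    using * by metis
qed

lemma block_subset:
  assumes "transversal_design k n X \<G> \<B>" and "A \<in> \<B>"
  shows "A \<subseteq> X"
  using assms by (simp add: transversal_design_def)

text \<open>Otherwise the pair would lie both in a group and in a block.\<close>

lemma group_inter_block_eq:
  assumes "transversal_design k n X \<G> \<B>" and "A \<in> \<B>" and "G \<in> \<G>"
    and "x \<in> A \<inter> G" and "y \<in> A \<inter> G"
  shows "x = y"
  using transversal_design_pair(1)[OF assms(1), of x y] block_subset[OF assms(1,2)] assms by blast

text \<open>Otherwise the pair would lie in two blocks. This keeps foreign summands of a
  transmission out of the set of subfiles that user \<open>A\<close> lacks.\<close>

lemma block_inter_block_eq:
  assumes "transversal_design k n X \<G> \<B>" and "A \<in> \<B>" and "B \<in> \<B>" and "A \<noteq> B"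
    and "x \<in> A \<inter> B" and "y \<in> A \<inter> B"
  shows "x = y"
  using transversal_design_pair(2)[OF assms(1), of x y A B] block_subset[OF assms(1,2)] assms by blast

text \<open>Groups are disjoint, so \<open>x\<close> and \<open>y\<close> are distinct and share no
  group; a block must then cover the pair.\<close>

lemma ex1_block:
  assumes "transversal_design k n X \<G> \<B>" and "G \<in> \<G>" and "H \<in> \<G>" and "G \<noteq> H"
    and "x \<in> G" and "y \<in> H"
  shows "\<exists>!A. A \<in> \<B> \<and> x \<in> A \<and> y \<in> A"
proof -
  have part: "partition_on X \<G>"
    using assms(1) by (simp add: transversal_design_def)
  have disj: "G' = H'" if "G' \<in> \<G>" "H' \<in> \<G>" "z \<in> G'" "z \<in> H'" for G' H' z
    using that partition_onD2[OF part] by (auto simp: disjoint_def)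
  have "x \<in> X" "y \<in> X"
    using partition_onD1[OF part] assms by blast+
  moreover have "x \<noteq> y"
    using assms disj by blast
  moreover have "\<not> (\<exists>G'\<in>\<G>. x \<in> G' \<and> y \<in> G')"
    using assms disj by blast
  ultimately show ?thesis
    using transversal_design_pair[OF assms(1), of x y] by blast
qed

text \<open>Pigeonhole: the \<open>k\<close> points of a block lie in distinct groups, and avoiding
  one of the \<open>k\<close> groups leaves room for only \<open>k - 1\<close> of them.\<close>

lemma block_meets_group:
  assumes td: "transversal_design k n X \<G> \<B>" and A: "A \<in> \<B>" and G: "G \<in> \<G>"
  shows "A \<inter> G \<noteq> {}"
proof
  assume empty: "A \<inter> G = {}"
  have part: "partition_on X \<G>" and AX: "A \<subseteq> X" and cA: "card A = k" and cG: "card \<G> = k"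
    and fX: "finite X" and k: "2 \<le> k"
    using td A by (auto simp: transversal_design_def)
  \<comment> \<open>An infinite set has \<open>card\<close> 0, so a positive \<open>k\<close> forces
    finiteness.\<close>
  have fG: "finite \<G>" using cG k by (auto intro: card_ge_0_finite)
  have "A = (\<Union>H\<in>\<G> - {G}. A \<inter> H)"
    using AX empty partition_onD1[OF part] by blast
  then have "card A \<le> (\<Sum>H\<in>\<G> - {G}. card (A \<inter> H))"
    using card_UN_le[of "\<G> - {G}" "\<lambda>H. A \<inter> H"] fG by simp
  also have "\<dots> \<le> (\<Sum>H\<in>\<G> - {G}. 1)"
  proof (rule sum_mono)
    fix H assume "H \<in> \<G> - {G}"
    then show "card (A \<inter> H) \<le> 1"
      using group_inter_block_eq[OF td A] finite_subset[OF AX fX]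
      by (auto simp: card_le_Suc0_iff_eq)
  qed
  also have "\<dots> = k - 1" using fG G cG by simp
  finally show False using cA k by simp
qed

lemma card_blocks:
  assumes td: "transversal_design k n X \<G> \<B>"
  shows "card \<B> = n\<^sup>2"
proof -
  have "2 \<le> card \<G>" using td by (auto simp: transversal_design_def)
  then obtain G H where GH: "G \<in> \<G>" "H \<in> \<G>" "G \<noteq> H"
    using card_le_Suc0_iff_eq[of \<G>] card_ge_0_finite[of \<G>] by fastforce
  \<comment> \<open>The description denotes an actual block for \<open>x\<close> in \<open>G\<close>
    and \<open>y\<close> in \<open>H\<close>, by \<open>ex1_block\<close>.\<close>
  define blk where "blk = (\<lambda>(x, y). THE A. A \<in> \<B> \<and> x \<in> A \<and> y \<in> A)"
  have blk: "blk (x, y) \<in> \<B> \<and> x \<in> blk (x, y) \<and> y \<in> blk (x, y)" if "x \<in> G" "y \<in> H" for x y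
    using theI'[OF ex1_block[OF td GH that]] by (simp add: blk_def)
  have "bij_betw blk (G \<times> H) \<B>"
    unfolding bij_betw_def
  proof (intro conjI equalityI subsetI)
    show "inj_on blk (G \<times> H)"
    proof (intro inj_onI, clarify)
      fix x y x' y'
      assume "x \<in> G" "y \<in> H" "x' \<in> G" "y' \<in> H" "blk (x, y) = blk (x', y')"
      then show "x = x' \<and> y = y'"
        using blk[of x y] blk[of x' y'] group_inter_block_eq[OF td _ GH(1)]
          group_inter_block_eq[OF td _ GH(2)] by (metis IntI)
    qed
  next
    fix A assume "A \<in> blk ` (G \<times> H)"
    then show "A \<in> \<B>" using blk by auto
  next
    \<comment> \<open>Surjectivity: \<open>A\<close> meets both groups, and uniqueness makes it the
      block through the two points found there.\<close>
    fix A assume A: "A \<in> \<B>"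
    obtain x y where xy: "x \<in> A" "x \<in> G" "y \<in> A" "y \<in> H"
      using block_meets_group[OF td A] GH by blast
    then have "A = blk (x, y)"
      using A blk[of x y] ex1_block[OF td GH, of x y] by blast
    then show "A \<in> blk ` (G \<times> H)" using xy by blast
  qed
  then have "card \<B> = card (G \<times> H)" by (metis bij_betw_same_card)
  also have "\<dots> = n\<^sup>2"
    using td GH by (simp add: transversal_design_def card_cartesian_product power2_eq_square)
  finally show ?thesis .
qed

text \<open>A decoder is just a function, so it suffices that cache and transmissions determine the
  demanded file: the decoder picks any library consistent with what it sees and reads the file
  off.\<close>

lemma can_recoverI:
  assumes "\<And>(W :: nat \<Rightarrow> 'f \<Rightarrow> 'g::ab_group_add) W' f.
      cache_content N F C u W = cache_content N F C u W' \<Longrightarrow>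
      (\<And>T. T \<in> set Ts \<Longrightarrow> transmitted W T = transmitted W' T) \<Longrightarrow>
      f \<in> F \<Longrightarrow> W (d u) f = W' (d u) f"
  shows "can_recover TYPE('g) N F C d Ts u"
proof -
  define decode :: "(nat \<Rightarrow> 'f \<Rightarrow> 'g option) \<Rightarrow> 'g list \<Rightarrow> 'f \<Rightarrow> 'g" where
    "decode c ts = (SOME W. cache_content N F C u W = c \<and> map (transmitted W) Ts = ts) (d u)" for c ts
  have "decode (cache_content N F C u W) (map (transmitted W) Ts) f = W (d u) f"
    if "f \<in> F" for W :: "nat \<Rightarrow> 'f \<Rightarrow> 'g" and f
  proof -
    let ?P = "\<lambda>W'. cache_content N F C u W' = cache_content N F C u W \<and>
      map (transmitted W') Ts = map (transmitted W) Ts"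
    \<comment> \<open>The true library \<open>W\<close> is itself consistent, so the choice
      succeeds.\<close>
    have "?P (SOME W'. ?P W')" by (rule someI[of ?P W]) simp
    then have "cache_content N F C u (SOME W'. ?P W') = cache_content N F C u W"
      and "\<And>T. T \<in> set Ts \<Longrightarrow> transmitted (SOME W'. ?P W') T = transmitted W T"
      by auto
    then show ?thesis
      unfolding decode_def using that by (rule assms)
  qed
  then show ?thesis unfolding can_recover_def by (intro exI[of _ decode]) simp
qed

theorem theorem4:
  fixes X :: "'x set" and \<G> \<B> :: "'x set set" and k n N :: nat
  assumes "transversal_design k n X \<G> \<B>"
    and "n \<le> k"
  shows "caching_matrix \<B> X (matrix_transpose incidence_matrix) (n\<^sup>2) (k * n) (1 / real n) \<and>
    (\<exists>S. valid_transmission_scheme TYPE('g::ab_group_add) N \<B> X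
            (matrix_transpose incidence_matrix) S \<and>
         has_rate N \<B> X S 1)"
proof
  let ?C = "matrix_transpose incidence_matrix :: 'x set \<Rightarrow> 'x \<Rightarrow> nat"
  note td = assms(1)
  have k: "2 \<le> k" and n: "1 \<le> n" and fX: "finite X" and cX: "card X = k * n"
    and blocks: "\<And>A. A \<in> \<B> \<Longrightarrow> A \<subseteq> X \<and> card A = k"
    using td by (auto simp: transversal_design_def)
  have fB: "finite \<B>"
    using blocks fX by (intro finite_subset[of \<B> "Pow X"]) auto
  have C: "?C A x = (if x \<in> A then 1 else 0)" for A x
    by (simp add: matrix_transpose_def incidence_matrix_def)
  show "caching_matrix \<B> X ?C (n\<^sup>2) (k * n) (1 / real n)"
    unfolding caching_matrix_def
  \<comment> \<open>Row \<open>A\<close> has its ones exactly at the points of \<open>A\<close>, so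
    \<open>Z = k\<close> and the uncached fraction is \<open>k / (k * n)\<close>.\<close>
  proof (intro conjI exI[of _ k] ballI)
    fix A assume "A \<in> \<B>"
    then have "{x \<in> X. ?C A x = 1} = A" using blocks by (auto simp: C)
    then show "card {x \<in> X. ?C A x = 1} = k" using blocks \<open>A \<in> \<B>\<close> by simp
  qed (use k n fX cX fB card_blocks[OF td] in \<open>auto simp: C\<close>)
  have "\<forall>A\<in>\<B>. \<exists>\<phi>. bij_betw \<phi> A A \<and> (\<forall>x\<in>A. \<phi> x \<noteq> x)"
    using ex_derangement blocks k fX by (metis finite_subset)
  then obtain \<phi> where \<phi>: "\<And>A. A \<in> \<B> \<Longrightarrow> bij_betw (\<phi> A) A A"
    and \<phi>_ne: "\<And>A x. A \<in> \<B> \<Longrightarrow> x \<in> A \<Longrightarrow> \<phi> A x \<noteq> x"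
    by metis
  obtain xs where xs: "set xs = X" "distinct xs"
    using fX finite_distinct_list by blast
  \<comment> \<open>No two blocks are merged in this image: blocks \<open>A\<close> and
    \<open>B\<close> through \<open>x\<close> with \<open>\<phi> A x = \<phi> B x\<close> share a
    second point, hence coincide.\<close>
  define T where "T d x = (\<lambda>A. (d A, \<phi> A x)) ` {A \<in> \<B>. x \<in> A}" for d :: "'x set \<Rightarrow> nat" and x
  define S where "S d = map (T d) xs" for d
  \<comment> \<open>The rate is \<open>card X / card X\<close>, which would be 0 instead of 1 if
    \<open>X\<close> were empty.\<close>
  have "0 < card X" using k n cX by simp
  then have "has_rate N \<B> X S 1"
    using xs(1) distinct_card[OF xs(2)] by (simp add: has_rate_def S_def)
  moreover have "valid_transmission_scheme TYPE('g) N \<B> X ?C S"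
    unfolding valid_transmission_scheme_def
  proof (intro ballI conjI)
    fix d Tr assume "Tr \<in> set (S d)"
    then show "Tr \<subseteq> d ` \<B> \<times> X"
      using blocks bij_betw_apply[OF \<phi>] by (fastforce simp: S_def T_def)
  next
    fix d A assume d: "d \<in> demands N \<B>" and A: "A \<in> \<B>"
    have d_in: "d B \<in> {1..N}" if "B \<in> \<B>" for B
      using d that by (auto simp: demands_def)
    show "can_recover TYPE('g) N X ?C d (S d) A"
    proof (rule can_recoverI)
      fix W W' :: "nat \<Rightarrow> 'x \<Rightarrow> 'g" and f
      assume cache: "cache_content N X ?C A W = cache_content N X ?C A W'"
        and trans: "\<And>T. T \<in> set (S d) \<Longrightarrow> transmitted W T = transmitted W' T" and f: "f \<in> X"
      have cached: "W i g = W' i g" if "i \<in> {1..N}" "g \<in> X" "g \<notin> A" for i g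
        using fun_cong[OF fun_cong[OF cache, of i], of g] that
        by (simp add: cache_content_def C)
      show "W (d A) f = W' (d A) f"
      proof (cases "f \<in> A")
        case False
        then show ?thesis using cached d_in A f by blast
      next
        case True
        \<comment> \<open>Subfile \<open>f\<close> is decoded from the transmission of its preimage
          \<open>x\<close> under \<open>\<phi> A\<close>, not from that of \<open>f\<close>.\<close>
        then obtain x where x: "x \<in> A" "f = \<phi> A x"
          using \<phi>[OF A] by (auto simp: bij_betw_def)
        have own: "(d A, f) \<in> T d x" and fin: "finite (T d x)"
          using A x fB by (auto simp: T_def)
        have others: "(case p of (i, g) \<Rightarrow> W i g) = (case p of (i, g) \<Rightarrow> W' i g)"
          if p: "p \<in> T d x - {(d A, f)}" for p
        proof -
          obtain B where B: "B \<in> \<B>" "x \<in> B" "p = (d B, \<phi> B x)" "B \<noteq> A"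
            using p x by (auto simp: T_def)
          have g: "\<phi> B x \<in> B" "\<phi> B x \<noteq> x"
            using bij_betw_apply[OF \<phi>] \<phi>_ne B by auto
          \<comment> \<open>Otherwise \<open>x\<close> and \<open>\<phi> B x\<close> would be two
            distinct common points of \<open>A\<close> and \<open>B\<close>.\<close>
          then have "\<phi> B x \<notin> A"
            using block_inter_block_eq[OF td A B(1)] B x by blast
          moreover have "\<phi> B x \<in> X"
            using g(1) block_subset[OF td B(1)] by blast
          ultimately show ?thesis
            using cached[OF d_in[OF B(1)]] B(3) by simp
        qed
        \<comment> \<open>Stated for any library \<open>V\<close>, so that the equal remainders can
          be cancelled between \<open>W\<close> and \<open>W'\<close>.\<close>
        have split: "transmitted V (T d x) =
            V (d A) f + (\<Sum>(i, g)\<in>T d x - {(d A, f)}. V i g)" for V :: "nat \<Rightarrow> 'x \<Rightarrow> 'g"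
          unfolding transmitted_def by (subst sum.remove[OF fin own]) simp
        have "transmitted W (T d x) = transmitted W' (T d x)"
        proof (rule trans)
          show "T d x \<in> set (S d)"
            using xs(1) block_subset[OF td A] x(1) by (auto simp: S_def)
        qed
        moreover have "(\<Sum>(i, g)\<in>T d x - {(d A, f)}. W i g) = (\<Sum>(i, g)\<in>T d x - {(d A, f)}. W' i g)"
          using others by (rule sum.cong[OF refl])
        ultimately show ?thesis by (simp add: split)
      qed
    qed
  qed
  ultimately show "\<exists>S. valid_transmission_scheme TYPE('g) N \<B> X ?C S \<and> has_rate N \<B> X S 1"
    by blast
qed

end
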